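(* Let $S=\langle n_0,\ldots,n_p\rangle$ be a numerical semigroup on a compound sequence (NSCS), with associated integers $a_1,\ldots,a_p,b_1,\ldots,b_p$. Set $r_1=1$ and $r_i=\left\lceil\frac{a_{i-1}r_{i-1}}{b_i}\right\rceil$ for $i\in[2,p]$. Set $s_p=1$ and $s_{i-1}=\left\lceil\frac{b_is_i}{a_{i-1}}\right\rceil$ for $i\in[2,p]$. Then the tame degree of $S$ satisfies \[t(S)\ge\max\{(b_1-a_1)r_1+(b_2-a_2)r_2+\cdots+(b_{p-1}-a_{p-1})r_{p-1}+b_pr_p,\ b_1s_1\}.\]
   Context: Let $\mathbb{N}$ be the positive integers and $\mathbb{N}_0$ the nonnegative integers. A compound sequence is a sequence $\{n_0,\ldots,n_p\}$ with $n_i=b_1b_2\cdots b_i\,a_{i+1}a_{i+2}\cdots a_p$ for $i\in[0,p]$, where $p,a_1,\ldots,a_p,b_1,\ldots,b_p\in\mathbb{N}$ satisfy $2\le a_i<b_i$ for all $i\in[1,p]$ and $\gcd(a_i,b_j)=1$ for all $i,j\in[1,p]$ with $i\ge j$. An NSCS is a numerical semigroup $S=\langle n_0,\ldots,n_p\rangle$ whose minimal generators form a compound sequence. The factorization homomorphism is $\phi:\mathbb{N}_0^{p+1}\to S$, $\phi(x_0,\ldots,x_p)=x_0n_0+\cdots+x_pn_p$; the elements of $\phi^{-1}(n)$ are the factorizations of $n$. For $x\in\mathbb{N}_0^{p+1}$, $|x|=x_0+\cdots+x_p$. For $x,y\in\mathbb{N}_0^{p+1}$, $\gcd(x,y)=(\min\{x_0,y_0\},\ldots,\min\{x_p,y_p\})$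 and $d(x,y)=\max\{|x-\gcd(x,y)|,|y-\gcd(x,y)|\}$; for $Y\subseteq\mathbb{N}_0^{p+1}$, $d(x,Y)=\min\{d(x,y):y\in Y\}$. For $n\in S$ and $i\in[0,p]$, $\phi_i^{-1}(n)=\{x\in\phi^{-1}(n):x_i>0\}$, and $t_i(n)=\max\{d(z,\phi_i^{-1}(n)):z\in\phi^{-1}(n)\}$ if $\phi_i^{-1}(n)\ne\emptyset$, $t_i(n)=-\infty$ otherwise. The tame degree of $n$ is $t(n)=\max\{t_i(n):i\in[0,p]\}$ and the tame degree of $S$ is $t(S)=\max\{t(n):n\in S\}$. *)

theory Defs
  imports "HOL-Library.Extended_Real"
begin

definition compound_params :: "nat \<Rightarrow> (nat \<Rightarrow> nat) \<Rightarrow> (nat \<Rightarrow> nat) \<Rightarrow> bool" where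
  "compound_params p a b \<longleftrightarrow>
     1 \<le> p \<and>
     (\<forall>i\<in>{1..p}. 2 \<le> a i \<and> a i < b i) \<and>
     (\<forall>i\<in>{1..p}. \<forall>j\<in>{1..p}. j \<le> i \<longrightarrow> coprime (a i) (b j))"

definition compound_seq :: "nat \<Rightarrow> (nat \<Rightarrow> nat) \<Rightarrow> (nat \<Rightarrow> nat) \<Rightarrow> nat \<Rightarrow> nat" where
  "compound_seq p a b i = (\<Prod>j\<in>{1..i}. b j) * (\<Prod>j\<in>{i+1..p}. a j)"

definition numerical_semigroup :: "nat set \<Rightarrow> bool" where
  "numerical_semigroup S \<longleftrightarrow>
     0 \<in> S \<and> (\<forall>x\<in>S. \<forall>y\<in>S. x + y \<in> S) \<and> finite (- S)"

inductive_set submonoid_gen :: "nat set \<Rightarrow> nat set" for G :: "nat set" where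
  zero: "0 \<in> submonoid_gen G"
| add: "g \<in> G \<Longrightarrow> x \<in> submonoid_gen G \<Longrightarrow> g + x \<in> submonoid_gen G"

definition minimal_generators :: "nat set \<Rightarrow> nat set \<Rightarrow> bool" where
  "minimal_generators S G \<longleftrightarrow>
     submonoid_gen G = S \<and> (\<forall>H. H \<subset> G \<longrightarrow> submonoid_gen H \<noteq> S)"

definition NSCS :: "nat \<Rightarrow> (nat \<Rightarrow> nat) \<Rightarrow> (nat \<Rightarrow> nat) \<Rightarrow> nat set \<Rightarrow> bool" where
  "NSCS p a b S \<longleftrightarrow>
     compound_params p a b \<and> numerical_semigroup S \<and>
     minimal_generators S (compound_seq p a b ` {0..p})"

text \<open>
  Tuples in \<open>\<nat>\<^sub>0\<^sup>p\<^sup>+\<^sup>1\<close> are functions on \<^typ>\<open>nat\<close> that vanish above \<open>p\<close>.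
\<close>

definition tuples :: "nat \<Rightarrow> (nat \<Rightarrow> nat) set" where
  "tuples p = {x. \<forall>i>p. x i = 0}"

definition tuple_sum :: "nat \<Rightarrow> (nat \<Rightarrow> nat) \<Rightarrow> nat" where
  "tuple_sum p x = (\<Sum>i\<in>{0..p}. x i)"

definition tuple_gcd :: "(nat \<Rightarrow> nat) \<Rightarrow> (nat \<Rightarrow> nat) \<Rightarrow> nat \<Rightarrow> nat" where
  "tuple_gcd x y = (\<lambda>i. min (x i) (y i))"

definition tuple_dist :: "nat \<Rightarrow> (nat \<Rightarrow> nat) \<Rightarrow> (nat \<Rightarrow> nat) \<Rightarrow> nat" where
  "tuple_dist p x y =
     max (tuple_sum p (\<lambda>i. x i - tuple_gcd x y i)) (tuple_sum p (\<lambda>i. y i - tuple_gcd x y i))"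

text \<open>The infimum of a nonempty set of naturals is its minimum.\<close>

definition tuple_setdist :: "nat \<Rightarrow> (nat \<Rightarrow> nat) \<Rightarrow> (nat \<Rightarrow> nat) set \<Rightarrow> nat" where
  "tuple_setdist p x Y = (INF y\<in>Y. tuple_dist p x y)"

definition fact_hom :: "nat \<Rightarrow> (nat \<Rightarrow> nat) \<Rightarrow> (nat \<Rightarrow> nat) \<Rightarrow> nat" where
  "fact_hom p n x = (\<Sum>i\<in>{0..p}. x i * n i)"

definition factorizations :: "nat \<Rightarrow> (nat \<Rightarrow> nat) \<Rightarrow> nat \<Rightarrow> (nat \<Rightarrow> nat) set" where
  "factorizations p n m = {x \<in> tuples p. fact_hom p n x = m}"

definition factorizations_at :: "nat \<Rightarrow> (nat \<Rightarrow> nat) \<Rightarrow> nat \<Rightarrow> nat \<Rightarrow> (nat \<Rightarrow> nat) set" where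
  "factorizations_at p n i m = {x \<in> factorizations p n m. 0 < x i}"

definition tame_degree_at :: "nat \<Rightarrow> (nat \<Rightarrow> nat) \<Rightarrow> nat \<Rightarrow> nat \<Rightarrow> ereal" where
  "tame_degree_at p n i m =
     (if factorizations_at p n i m \<noteq> {}
      then ereal (real (Max ((\<lambda>z. tuple_setdist p z (factorizations_at p n i m)) `
                              factorizations p n m)))
      else - \<infinity>)"

definition tame_degree_elem :: "nat \<Rightarrow> (nat \<Rightarrow> nat) \<Rightarrow> nat \<Rightarrow> ereal" where
  "tame_degree_elem p n m = Max ((\<lambda>i. tame_degree_at p n i m) ` {0..p})"

definition tame_degree :: "nat \<Rightarrow> (nat \<Rightarrow> nat) \<Rightarrow> nat set \<Rightarrow> ereal" where
  "tame_degree p n S = Max (tame_degree_elem p n ` S)"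

text \<open>
  The maxima above are over nonempty finite sets, so that \<^const>\<open>Max\<close> is meaningful:
  \<open>finite_factorizations\<close> and \<open>finite_tame_degree_elem_image\<close>.
\<close>

lemma finite_factorizations:
  assumes pos: "\<And>i. i \<le> p \<Longrightarrow> 0 < n i"
  shows "finite (factorizations p n m)"
proof (rule finite_subset)
  show "factorizations p n m \<subseteq> {x. \<forall>i. (i \<in> {0..p} \<longrightarrow> x i \<in> {0..m}) \<and> (i \<notin> {0..p} \<longrightarrow> x i = 0)}"
  proof (clarsimp simp: factorizations_def tuples_def fact_hom_def)
    fix x i assume i: "i \<le> p"
    have "x i \<le> x i * n i" using pos[OF i] by simp
    also have "\<dots> \<le> (\<Sum>i = 0..p. x i * n i)"
      by (rule member_le_sum) (use i in auto)
    finally show "x i \<le> (\<Sum>i = 0..p. x i * n i)" .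
  qed
  show "finite {x :: nat \<Rightarrow> nat. \<forall>i. (i \<in> {0..p} \<longrightarrow> x i \<in> {0..m}) \<and> (i \<notin> {0..p} \<longrightarrow> x i = 0)}"
    by (rule finite_set_of_finite_funs) auto
qed

lemma tuple_sum_le_fact_hom:
  assumes pos: "\<And>i. i \<le> p \<Longrightarrow> 0 < n i"
  shows "tuple_sum p x \<le> fact_hom p n x"
  unfolding tuple_sum_def fact_hom_def
  by (rule sum_mono) (use pos in \<open>auto simp: Suc_le_eq\<close>)

lemma tuple_dist_le:
  "tuple_dist p x y \<le> max (tuple_sum p x) (tuple_sum p y)"
proof -
  have "tuple_sum p (\<lambda>i. x i - g i) \<le> tuple_sum p x" for x g
    unfolding tuple_sum_def by (rule sum_mono) auto
  thus ?thesis unfolding tuple_dist_def by (meson max.mono)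
qed

lemma tuple_setdist_bounded:
  assumes pos: "\<And>i. i \<le> p \<Longrightarrow> 0 < n i"
    and i: "i \<le> p"
    and z: "z \<in> factorizations p n m" and ne: "factorizations_at p n i m \<noteq> {}"
  shows "tuple_setdist p z (factorizations_at p n i m) \<le> 2 * n i * (\<Sum>j\<in>{0..p}. n j)"
    (is "_ \<le> ?C")
proof -
  have setdist_le: "tuple_setdist p z (factorizations_at p n i m) \<le> tuple_dist p z y"
    if "y \<in> factorizations_at p n i m" for y
    unfolding tuple_setdist_def by (rule cINF_lower) (use that in auto)
  have nj: "n j \<le> (\<Sum>j\<in>{0..p}. n j)" if "j \<le> p" for j
    by (rule member_le_sum) (use that in auto)
  show ?thesis
  proof (cases "\<exists>j\<le>p. j \<noteq> i \<and> n i \<le> z j")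
    case True
    then obtain j where j: "j \<le> p" "j \<noteq> i" "n i \<le> z j" by blast
    define y where "y = z(i := z i + n j, j := z j - n i)"
    have split: "(\<Sum>k\<in>{0..p}. f k) = f i + (f j + (\<Sum>k\<in>{0..p} - {i} - {j}. f k))"
      for f :: "nat \<Rightarrow> nat"
      using i j by (simp add: sum.remove[of "{0..p}" i] sum.remove[of "{0..p} - {i}" j])
    have rest: "(\<Sum>k\<in>{0..p} - {i} - {j}. y k * n k) = (\<Sum>k\<in>{0..p} - {i} - {j}. z k * n k)"
      by (rule sum.cong) (auto simp: y_def)
    have "n j * n i + (z j - n i) * n j = z j * n j"
      using j by (metis add_mult_distrib le_add_diff_inverse mult.commute)
    hence "fact_hom p n y = fact_hom p n z"
      unfolding fact_hom_def split rest using j by (simp add: y_def add_mult_distrib)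
    hence yf: "y \<in> factorizations_at p n i m"
      using z i j pos[of j]
      by (auto simp: factorizations_at_def factorizations_def tuples_def y_def)
    have "tuple_sum p (\<lambda>k. z k - tuple_gcd z y k) \<le> n i"
    proof -
      have "(\<Sum>k\<in>{0..p} - {i} - {j}. z k - tuple_gcd z y k) = 0"
        by (auto simp: y_def tuple_gcd_def)
      thus ?thesis unfolding tuple_sum_def split using j by (simp add: y_def tuple_gcd_def)
    qed
    moreover have "tuple_sum p (\<lambda>k. y k - tuple_gcd z y k) \<le> n j"
    proof -
      have "(\<Sum>k\<in>{0..p} - {i} - {j}. y k - tuple_gcd z y k) = 0"
        by (auto simp: y_def tuple_gcd_def)
      thus ?thesis unfolding tuple_sum_def split using j by (simp add: y_def tuple_gcd_def)
    qed
    ultimately have "tuple_dist p z y \<le> max (n i) (n j)"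
      unfolding tuple_dist_def by (meson max.mono)
    also have "\<dots> \<le> (\<Sum>j\<in>{0..p}. n j)" using nj i j by simp
    also have "\<dots> \<le> ?C" using pos[OF i] by simp
    finally show ?thesis using setdist_le[OF yf] by linarith
  next
    case False
    show ?thesis
    proof (cases "0 < z i")
      case True
      hence "z \<in> factorizations_at p n i m" using z by (simp add: factorizations_at_def)
      moreover have "tuple_dist p z z = 0" by (simp add: tuple_dist_def tuple_gcd_def tuple_sum_def)
      ultimately show ?thesis using setdist_le[of z] by simp
    next
      case zi: False
      have "m = (\<Sum>j\<in>{0..p}. z j * n j)"
        using z by (simp add: factorizations_def fact_hom_def)
      also have "\<dots> \<le> (\<Sum>j\<in>{0..p}. n i * n j)"
      proof (rule sum_mono)
        fix j assume "j \<in> {0..p}"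
        hence "z j \<le> n i" using False zi by (cases "j = i") auto
        thus "z j * n j \<le> n i * n j" by simp
      qed
      finally have m: "m \<le> n i * (\<Sum>j\<in>{0..p}. n j)" by (simp add: sum_distrib_left)
      obtain y where y: "y \<in> factorizations_at p n i m" using ne by blast
      have "tuple_sum p y \<le> m" "tuple_sum p z \<le> m"
        using y z tuple_sum_le_fact_hom[of p n y, OF pos] tuple_sum_le_fact_hom[of p n z, OF pos]
        by (auto simp: factorizations_at_def factorizations_def)
      hence "tuple_dist p z y \<le> m" using tuple_dist_le[of p z y] by simp
      thus ?thesis using setdist_le[OF y] m by linarith
    qed
  qed
qed

lemma finite_tame_degree_elem_image:
  assumes pos: "\<And>i. i \<le> p \<Longrightarrow> 0 < n i"
  shows "finite (tame_degree_elem p n ` S)"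
proof (rule finite_subset)
  let ?s = "\<Sum>j\<in>{0..p}. n j"
  let ?V = "insert (- \<infinity>) ((\<lambda>k. ereal (real k)) ` {0..2 * ?s * ?s})"
  show "finite ?V" by simp
  show "tame_degree_elem p n ` S \<subseteq> ?V"
  proof
    fix v assume "v \<in> tame_degree_elem p n ` S"
    then obtain m where v: "v = Max ((\<lambda>i. tame_degree_at p n i m) ` {0..p})"
      by (auto simp: tame_degree_elem_def)
    have "v \<in> (\<lambda>i. tame_degree_at p n i m) ` {0..p}" unfolding v by (rule Max_in) auto
    then obtain i where i: "i \<le> p" and vi: "v = tame_degree_at p n i m" by auto
    show "v \<in> ?V"
    proof (cases "factorizations_at p n i m = {}")
      case True thus ?thesis by (simp add: vi tame_degree_at_def)
    next
      case False
      let ?D = "(\<lambda>z. tuple_setdist p z (factorizations_at p n i m)) ` factorizations p n m"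
      have "?D \<noteq> {}" using False by (auto simp: factorizations_at_def)
      moreover have "finite ?D" using finite_factorizations[of p n m, OF pos] by simp
      ultimately have "Max ?D \<in> ?D" by (rule Max_in[rotated])
      then obtain z where "z \<in> factorizations p n m"
        "Max ?D = tuple_setdist p z (factorizations_at p n i m)" by auto
      hence "Max ?D \<le> 2 * n i * ?s"
        using tuple_setdist_bounded[of p n i z m, OF pos i _ False] by simp
      also have "\<dots> \<le> 2 * ?s * ?s"
        using member_le_sum[of i "{0..p}" n] i by simp
      finally show ?thesis using False by (auto simp: vi tame_degree_at_def)
    qed
  qed
qed

end

theory Submission
  imports Defs
begin

text \<open>
  Consecutive generators satisfy \<open>b\<^sub>i n\<^sub>i\<^sub>-\<^sub>1 = a\<^sub>i n\<^sub>i\<close>, and coprimality forces every relation to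
  pass through these trades. Trading \<open>b\<^sub>1 s\<^sub>1\<close> copies of \<open>n\<^sub>0\<close> upwards step by step, \<open>s\<^sub>1\<close> is the
  least multiplicity for which a copy of \<open>n\<^sub>p\<close> can be produced. So a factorization of
  \<open>b\<^sub>1 s\<^sub>1 n\<^sub>0\<close> using \<open>n\<^sub>p\<close> cannot use \<open>n\<^sub>0\<close>, and it is at distance at least \<open>b\<^sub>1 s\<^sub>1\<close> from
  \<open>b\<^sub>1 s\<^sub>1\<close> copies of \<open>n\<^sub>0\<close>. Symmetrically, trading downwards, a factorization of \<open>a\<^sub>p r\<^sub>p n\<^sub>p\<close>
  using \<open>n\<^sub>0\<close> cannot use \<open>n\<^sub>p\<close>; its length is at least the one obtained by the cheapest chain of
  trades, which is the first term of the maximum.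
\<close>

text \<open>The tame degree is an iterated maximum, so one element \<open>m\<close>, one index
  \<open>i\<close> and one factorization \<open>z\<close> bound it from below. Only the innermost
  distance is a minimum, so it needs a bound for every \<open>y\<close>.\<close>

lemma tame_degree_ge:
  assumes pos: "\<And>i. i \<le> p \<Longrightarrow> 0 < n i"
    and "m \<in> S" and i: "i \<le> p"
    and z: "z \<in> factorizations p n m"
    and ne: "factorizations_at p n i m \<noteq> {}"
    and dist: "\<And>y. y \<in> factorizations_at p n i m \<Longrightarrow> k \<le> tuple_dist p z y"
  shows "ereal (real k) \<le> tame_degree p n S"
proof -
  have "k \<le> tuple_setdist p z (factorizations_at p n i m)"
    unfolding tuple_setdist_def using ne dist by (rule cINF_greatest)
  also have "\<dots> \<le> Max ((\<lambda>z. tuple_setdist p z (factorizations_at p n i m)) ` factorizations p n m)"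
    using finite_factorizations[of p n m, OF pos] z by (intro Max_ge) auto
  finally have "ereal (real k) \<le> tame_degree_at p n i m"
    using ne by (simp add: tame_degree_at_def)
  also have "\<dots> \<le> tame_degree_elem p n m"
    unfolding tame_degree_elem_def using i by (intro Max_ge) auto
  also have "\<dots> \<le> tame_degree p n S"
    unfolding tame_degree_def
    using finite_tame_degree_elem_image[of p n S, OF pos] \<open>m \<in> S\<close> by (intro Max_ge) auto
  finally show ?thesis .
qed

lemma submonoid_gen_multiple:
  assumes "g \<in> G"
  shows "c * g \<in> submonoid_gen G"
  using assms by (induction c) (auto intro: submonoid_gen.intros)

text \<open>The ceiling of \<open>u * c / v\<close> is the least natural \<open>x\<close> with
  \<open>u * c \<le> v * x\<close>. The recurrences for \<open>r\<close> and \<open>s\<close> enter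
  the proof in this division-free form; \<open>0 \<le> t\<close> makes \<open>nat\<close>
  lossless.\<close>

lemma ceiling_divide_nat_least:
  fixes u v c :: nat and t t' :: int
  assumes t: "t = \<lceil>real u * real_of_int t' / real v\<rceil>" and "0 < v" and "0 \<le> t'" and c: "c = nat t'"
  shows "u * c \<le> v * nat t" and "u * c \<le> v * x \<Longrightarrow> nat t \<le> x" and "0 \<le> t"
proof -
  have t': "real_of_int t' = real c" using assms by simp
  have eq: "t = \<lceil>real (u * c) / real v\<rceil>" using t t' by simp
  show "0 \<le> t" unfolding eq by (simp add: less_le_trans[of "-1" 0])
  then have nt: "real (nat t) = real_of_int t" by simp
  have "real (u * c) / real v \<le> real (nat t)" unfolding nt eq by linarith
  then have "real (u * c) \<le> real (v * nat t)"
    using \<open>0 < v\<close> by (simp add: divide_le_eq mult.commute)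
  then show "u * c \<le> v * nat t" by (simp only: of_nat_le_iff)
  assume "u * c \<le> v * x"
  then have "real (u * c) \<le> real (v * x)" by (simp only: of_nat_le_iff)
  then have "real (u * c) / real v \<le> real x"
    using \<open>0 < v\<close> by (simp add: divide_le_eq mult.commute)
  then have "t \<le> int x" unfolding eq by (simp add: ceiling_le_iff)
  then show "nat t \<le> x" by simp
qed

section \<open>Trades between neighbouring generators and the divisibility they force\<close>

locale compound =
  fixes p :: nat and a b :: "nat \<Rightarrow> nat"
  assumes params: "compound_params p a b"
begin

abbreviation n :: "nat \<Rightarrow> nat" where
  "n \<equiv> compound_seq p a b"

lemma p_pos: "1 \<le> p"
  and a_ge: "i \<in> {1..p} \<Longrightarrow> 2 \<le> a i"
  and a_less_b: "i \<in> {1..p} \<Longrightarrow> a i < b i"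
  and coprime_a_b: "i \<in> {1..p} \<Longrightarrow> j \<in> {1..p} \<Longrightarrow> j \<le> i \<Longrightarrow> coprime (a i) (b j)"
  using params by (auto simp: compound_params_def)

lemma a_pos: "i \<in> {1..p} \<Longrightarrow> 0 < a i"
  using a_ge[of i] by simp

lemma b_pos: "i \<in> {1..p} \<Longrightarrow> 0 < b i"
  using a_less_b[of i] by simp

lemma n_pos: "i \<le> p \<Longrightarrow> 0 < n i"
  unfolding compound_seq_def by (auto intro!: prod_pos a_pos b_pos)

lemma trade:
  assumes "i < p"
  shows "b (Suc i) * n i = a (Suc i) * n (Suc i)"
proof -
  have "(\<Prod>j\<in>{i+1..p}. a j) = a (Suc i) * (\<Prod>j\<in>{Suc i+1..p}. a j)"
    using assms by (simp add: prod.atLeast_Suc_atMost)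
  then show ?thesis by (simp add: compound_seq_def)
qed

text \<open>Each \<open>n j\<close> on the right is a multiple of
  \<open>b 1 * ... * b (Suc i)\<close>. In \<open>n i\<close> the factor \<open>b (Suc i)\<close> is
  missing, and the \<open>a k\<close> with \<open>k > i\<close> standing there are coprime to it, so
  \<open>x\<close> must supply it.\<close>

lemma b_dvd:
  assumes "i < p" and eq: "x * n i = (\<Sum>j\<in>{Suc i..p}. y j * n j)"
  shows "b (Suc i) dvd x"
proof -
  let ?P = "\<Prod>j\<in>{1..i}. b j" and ?A = "\<Prod>j\<in>{i+1..p}. a j"
  have "?P * b (Suc i) dvd n j" if "j \<in> {Suc i..p}" for j
  proof -
    have "(\<Prod>k\<in>{1..Suc i}. b k) dvd (\<Prod>k\<in>{1..j}. b k)"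
      using that by (intro prod_dvd_prod_subset) auto
    then show ?thesis by (simp add: compound_seq_def)
  qed
  then have "?P * b (Suc i) dvd x * n i" unfolding eq by (intro dvd_sum) auto
  also have "x * n i = ?P * (x * ?A)" by (simp add: compound_seq_def)
  finally have "?P * b (Suc i) dvd ?P * (x * ?A)" .
  moreover have "0 < ?P" using \<open>i < p\<close> by (intro prod_pos b_pos) auto
  ultimately have "b (Suc i) dvd x * ?A" by (simp only: nat_mult_dvd_cancel1)
  moreover have "coprime (b (Suc i)) ?A"
    using \<open>i < p\<close> by (intro prod_coprime_right) (auto intro: coprime_a_b simp: coprime_commute)
  ultimately show ?thesis by (simp add: coprime_dvd_mult_left_iff)
qed

text \<open>Mirror image of \<open>b_dvd\<close>: the lower generators share all \<open>a k\<close>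
  with \<open>k > i\<close>, while \<open>n (Suc i)\<close> has lost \<open>a (Suc i)\<close> and
  contains only \<open>b j\<close> with \<open>j \<le> Suc i\<close>, coprime to it.\<close>

lemma a_dvd:
  assumes "i < p" and eq: "x * n (Suc i) = (\<Sum>j\<le>i. y j * n j)"
  shows "a (Suc i) dvd x"
proof -
  let ?P = "\<Prod>j\<in>{1..Suc i}. b j" and ?A = "\<Prod>j\<in>{Suc i+1..p}. a j"
  have "?A * a (Suc i) dvd n j" if "j \<le> i" for j
  proof -
    have "(\<Prod>k\<in>{Suc i..p}. a k) dvd (\<Prod>k\<in>{j+1..p}. a k)"
      using that by (intro prod_dvd_prod_subset) auto
    moreover have "(\<Prod>k\<in>{Suc i..p}. a k) = ?A * a (Suc i)"
      using \<open>i < p\<close> by (simp add: prod.atLeast_Suc_atMost)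
    ultimately show ?thesis by (simp add: compound_seq_def)
  qed
  then have "?A * a (Suc i) dvd x * n (Suc i)" unfolding eq by (intro dvd_sum) auto
  also have "x * n (Suc i) = ?A * (x * ?P)" by (simp add: compound_seq_def)
  finally have "?A * a (Suc i) dvd ?A * (x * ?P)" .
  moreover have "0 < ?A" by (intro prod_pos a_pos) auto
  ultimately have "a (Suc i) dvd x * ?P" by (simp only: nat_mult_dvd_cancel1)
  moreover have "coprime (a (Suc i)) ?P"
    using \<open>i < p\<close> by (intro prod_coprime_right coprime_a_b) auto
  ultimately show ?thesis using coprime_dvd_mult_left_iff by blast
qed

section \<open>Trading copies of low generators upwards to \<open>n p\<close>\<close>

text \<open>Divisibility splits the \<open>x\<close> copies into \<open>x'\<close> trades, which
  yield \<open>a (Suc i) * x'\<close> copies of \<open>n (Suc i)\<close>. Those beyond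
  \<open>y (Suc i)\<close> obey the same kind of relation one level up, so induction and the
  minimality of \<open>s (Suc i)\<close> give \<open>s (Suc i) \<le> x'\<close>.\<close>

lemma upward_trades_lower_bound:
  fixes s :: "nat \<Rightarrow> nat"
  assumes sp: "s p = 1"
    and least: "\<And>i x. 1 \<le> i \<Longrightarrow> i < p \<Longrightarrow> b (Suc i) * s (Suc i) \<le> a i * x \<Longrightarrow> s i \<le> x"
    and "0 < y p" and "i < p" and "x * n i = (\<Sum>j\<in>{Suc i..p}. y j * n j)"
  shows "b (Suc i) * s (Suc i) \<le> x"
  using assms(4,5)
proof (induction "p - i" arbitrary: i x rule: less_induct)
  case less
  obtain x' where x': "x = b (Suc i) * x'" using b_dvd[OF less.prems] by blast
  have "a (Suc i) * x' * n (Suc i) = (\<Sum>j\<in>{Suc i..p}. y j * n j)"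
    using less.prems(2) trade[OF \<open>i < p\<close>] by (simp add: x' mult.commute mult.left_commute)
  also have "\<dots> = y (Suc i) * n (Suc i) + (\<Sum>j\<in>{Suc (Suc i)..p}. y j * n j)"
    using \<open>i < p\<close> by (simp add: sum.atLeast_Suc_atMost)
  finally have eq: "a (Suc i) * x' * n (Suc i) = \<dots>" .
  have "s (Suc i) \<le> x'"
  proof (cases "Suc i = p")
    case True
    \<comment> \<open>At the top level \<open>y p > 0\<close> forces at least one trade, and
      \<open>s p = 1\<close>.\<close>
    then have "0 < a p * x' * n p" using eq n_pos[of p] \<open>0 < y p\<close> by simp
    then show ?thesis using True sp by simp
  next
    case False
    with \<open>i < p\<close> have i: "Suc i < p" by simp
    have "(a (Suc i) * x' - y (Suc i)) * n (Suc i) = (\<Sum>j\<in>{Suc (Suc i)..p}. y j * n j)"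
      using eq by (simp add: diff_mult_distrib)
    with i have "b (Suc (Suc i)) * s (Suc (Suc i)) \<le> a (Suc i) * x' - y (Suc i)"
      by (intro less.hyps) auto
    then show ?thesis using i by (intro least) auto
  qed
  then show ?case by (simp add: x')
qed

text \<open>Trade all copies one level up, keep the surplus there and pass on only the copies that
  the next level requires.\<close>

lemma upward_trades_exist:
  fixes s :: "nat \<Rightarrow> nat"
  assumes sp: "s p = 1"
    and enough: "\<And>i. 1 \<le> i \<Longrightarrow> i < p \<Longrightarrow> b (Suc i) * s (Suc i) \<le> a i * s i"
    and "i < p"
  shows "\<exists>y. 0 < y p \<and> b (Suc i) * s (Suc i) * n i = (\<Sum>j\<in>{Suc i..p}. y j * n j)"
  using \<open>i < p\<close>
proof (induction "p - i" arbitrary: i rule: less_induct)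
  case less
  have tr: "b (Suc i) * s (Suc i) * n i = a (Suc i) * s (Suc i) * n (Suc i)"
    using trade[OF \<open>i < p\<close>] by (simp add: mult.commute mult.left_commute)
  show ?case
  proof (cases "Suc i = p")
    case True
    \<comment> \<open>The sum has the single index \<open>p\<close>, so only the value at
      \<open>p\<close> counts.\<close>
    then show ?thesis using tr sp a_pos[of p] p_pos by (intro exI[of _ "\<lambda>_. a p"]) auto
  next
    case False
    with \<open>i < p\<close> have i: "Suc i < p" by simp
    let ?c = "b (Suc (Suc i)) * s (Suc (Suc i))"
    obtain y where y: "0 < y p" "?c * n (Suc i) = (\<Sum>j\<in>{Suc (Suc i)..p}. y j * n j)"
      using less.hyps[of "Suc i"] i by (auto simp: diff_less_mono2)
    let ?y = "y(Suc i := a (Suc i) * s (Suc i) - ?c)"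
    have "(\<Sum>j\<in>{Suc i..p}. ?y j * n j) = ?y (Suc i) * n (Suc i) + (\<Sum>j\<in>{Suc (Suc i)..p}. ?y j * n j)"
      using \<open>i < p\<close> by (simp add: sum.atLeast_Suc_atMost)
    also have "(\<Sum>j\<in>{Suc (Suc i)..p}. ?y j * n j) = ?c * n (Suc i)"
      unfolding y by (rule sum.cong) auto
    also have "?y (Suc i) * n (Suc i) + ?c * n (Suc i) = a (Suc i) * s (Suc i) * n (Suc i)"
      using enough[of "Suc i"] i by (simp flip: add_mult_distrib)
    finally show ?thesis using tr y(1) i by (intro exI[of _ ?y]) auto
  qed
qed

section \<open>Trading copies of high generators downwards to \<open>n 0\<close>, with control of
  the length\<close>

text \<open>The induction must track the length for every \<open>x\<close>, not just the least one:
  the excess of \<open>x\<close> over \<open>a (Suc i) * r (Suc i)\<close> consists of whole further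
  trades, and no trade downwards shortens a factorization.\<close>

lemma downward_trades_lower_bound:
  fixes r :: "nat \<Rightarrow> nat"
  assumes r1: "r 1 = 1"
    and least: "\<And>i x. 1 \<le> i \<Longrightarrow> i < p \<Longrightarrow> a i * r i \<le> b (Suc i) * x \<Longrightarrow> r (Suc i) \<le> x"
    and "0 < y 0" and "i < p" and "x * n (Suc i) = (\<Sum>j\<le>i. y j * n j)"
  shows "a (Suc i) * r (Suc i) \<le> x \<and>
    (\<Sum>j\<in>{1..i}. (int (b j) - int (a j)) * int (r j)) + int (b (Suc i) * r (Suc i))
      + (int x - int (a (Suc i) * r (Suc i))) \<le> int (\<Sum>j\<le>i. y j)"
  using assms(4,5)
proof (induction i arbitrary: x)
  case 0
  obtain x' where x': "x = a (Suc 0) * x'" using a_dvd[OF 0] by blast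
  have "b (Suc 0) * x' * n 0 = y 0 * n 0"
    using 0(2) trade[OF 0(1)] by (simp add: x' mult.commute mult.left_commute)
  then have y0: "y 0 = b (Suc 0) * x'" using n_pos[of 0] by simp
  with \<open>0 < y 0\<close> obtain d where d: "x' = Suc d" by (cases x') auto
  have "int (a (Suc 0)) * int d \<le> int (b (Suc 0)) * int d"
    using a_less_b[of 1] p_pos by (intro mult_right_mono) auto
  then show ?case using r1 by (simp add: y0 x' d)
next
  case (Suc i)
  let ?i = "Suc i" and ?k = "Suc (Suc i)"
  obtain x' where x': "x = a ?k * x'" using a_dvd[OF Suc.prems] by blast
  have eq: "b ?k * x' * n ?i = (\<Sum>j\<le>i. y j * n j) + y ?i * n ?i"
    using Suc.prems(2) trade[OF Suc.prems(1)] by (simp add: x' mult.commute mult.left_commute)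
  \<comment> \<open>Of the \<open>b ?k * x'\<close> copies of \<open>n ?i\<close> obtained by
    trading, \<open>y ?i\<close> stay and \<open>x''\<close> are traded further down.\<close>
  define x'' where "x'' = b ?k * x' - y ?i"
  have "x'' * n ?i = (\<Sum>j\<le>i. y j * n j)"
    using eq by (simp add: x''_def diff_mult_distrib)
  note IH = Suc.IH[OF _ this]
  have "y ?i * n ?i \<le> b ?k * x' * n ?i" using eq by simp
  then have x'': "b ?k * x' = x'' + y ?i" using n_pos[of ?i] Suc.prems(1) by (simp add: x''_def)
  have "a ?i * r ?i \<le> b ?k * x'" using IH Suc.prems(1) x'' by simp
  then have "r ?k \<le> x'" using Suc.prems(1) by (intro least) auto
  then obtain d where d: "x' = r ?k + d" using le_Suc_ex by blast
  \<comment> \<open>The \<open>d\<close> trades beyond \<open>r ?k\<close> use up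
    \<open>a ?k * d\<close> copies and produce \<open>b ?k * d\<close>, so the excess carries over
    to the length.\<close>
  have "int (a ?k) * int d \<le> int (b ?k) * int d"
    using a_less_b[of ?k] Suc.prems(1) by (intro mult_right_mono) auto
  moreover have "int (b ?k) * (int (r ?k) + int d) = int x'' + int (y ?i)"
    using x'' unfolding d by (metis of_nat_add of_nat_mult)
  ultimately show ?case using IH Suc.prems(1) by (simp add: x' d algebra_simps)
qed

lemma downward_trades_exist:
  fixes r :: "nat \<Rightarrow> nat"
  assumes r1: "r 1 = 1"
    and enough: "\<And>i. 1 \<le> i \<Longrightarrow> i < p \<Longrightarrow> a i * r i \<le> b (Suc i) * r (Suc i)"
    and "i < p"
  shows "\<exists>y. 0 < y 0 \<and> a (Suc i) * r (Suc i) * n (Suc i) = (\<Sum>j\<le>i. y j * n j)"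
  using \<open>i < p\<close>
proof (induction i)
  case 0
  then show ?case using trade[OF 0] r1 b_pos[of 1] p_pos by (intro exI[of _ "\<lambda>_. b 1"]) simp
next
  case (Suc i)
  let ?i = "Suc i" and ?k = "Suc (Suc i)"
  let ?c = "a ?i * r ?i"
  obtain y where y: "0 < y 0" "?c * n ?i = (\<Sum>j\<le>i. y j * n j)"
    using Suc by auto
  let ?y = "y(?i := b ?k * r ?k - ?c)"
  have "(\<Sum>j\<le>?i. ?y j * n j) = ?c * n ?i + ?y ?i * n ?i"
    by (simp add: y)
  also have "\<dots> = b ?k * r ?k * n ?i"
    using enough[of ?i] Suc.prems by (simp flip: add_mult_distrib)
  also have "\<dots> = a ?k * r ?k * n ?k"
    using trade[OF Suc.prems] by (simp add: mult.commute mult.left_commute)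
  finally show ?case using y(1) by (intro exI[of _ ?y]) auto
qed

section \<open>From relations between generators to bounds on the tame degree\<close>

lemma fact_hom_first: "fact_hom p n y = y 0 * n 0 + (\<Sum>j\<in>{Suc 0..p}. y j * n j)"
  unfolding fact_hom_def by (simp add: sum.atLeast_Suc_atMost)

lemma fact_hom_last:
  assumes "p = Suc q"
  shows "fact_hom p n y = y p * n p + (\<Sum>j\<le>q. y j * n j)"
  unfolding fact_hom_def by (simp add: assms atLeast0AtMost)

lemma single_factorization:
  assumes "i \<le> p"
  shows "(\<lambda>j. if j = i then c else 0) \<in> factorizations p n (c * n i)"
proof -
  have "(\<Sum>j\<in>{0..p}. (if j = i then c else 0) * n j) = (\<Sum>j\<in>{0..p}. if j = i then c * n j else 0)"
    by (rule sum.cong) auto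
  then show ?thesis
    using assms by (simp add: factorizations_def tuples_def fact_hom_def)
qed

text \<open>The functions built by trading may take any values above \<open>p\<close>; cutting these
  off turns them into tuples.\<close>

lemma truncated_factorization:
  assumes "fact_hom p n y = m" and "i \<le> p" and "0 < y i"
  shows "(\<lambda>j. if j \<le> p then y j else 0) \<in> factorizations_at p n i m"
proof -
  have "fact_hom p n (\<lambda>j. if j \<le> p then y j else 0) = fact_hom p n y"
    unfolding fact_hom_def by (rule sum.cong) auto
  then show ?thesis
    using assms by (simp add: factorizations_at_def factorizations_def tuples_def)
qed

lemma tame_degree_ge_upward:
  fixes s :: "nat \<Rightarrow> nat"
  assumes sp: "s p = 1"
    and enough: "\<And>i. 1 \<le> i \<Longrightarrow> i < p \<Longrightarrow> b (Suc i) * s (Suc i) \<le> a i * s i"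
    and least: "\<And>i x. 1 \<le> i \<Longrightarrow> i < p \<Longrightarrow> b (Suc i) * s (Suc i) \<le> a i * x \<Longrightarrow> s i \<le> x"
    and S: "S = submonoid_gen (n ` {0..p})"
  shows "ereal (real (b 1 * s 1)) \<le> tame_degree p n S"
proof -
  let ?c = "b 1 * s 1" and ?z = "\<lambda>j::nat. if j = 0 then b 1 * s 1 else 0"
  have p: "0 < p" using p_pos by simp
  have dist: "?c \<le> tuple_dist p ?z y" if y: "y \<in> factorizations_at p n p (?c * n 0)" for y
  proof -
    have yp: "0 < y p" and eq: "?c * n 0 = y 0 * n 0 + (\<Sum>j\<in>{Suc 0..p}. y j * n j)"
      using y fact_hom_first[of y] by (auto simp: factorizations_at_def factorizations_def)
    have "(?c - y 0) * n 0 = (\<Sum>j\<in>{Suc 0..p}. y j * n j)"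
      using eq by (simp add: diff_mult_distrib)
    from upward_trades_lower_bound[where s = s, OF sp least yp p this]
    have le: "?c \<le> ?c - y 0" by simp
    \<comment> \<open>Under truncated subtraction \<open>le\<close> would also hold for
      \<open>?c = 0\<close>; with \<open>y 0 \<le> ?c\<close> it yields \<open>y 0 = 0\<close> in
      every case.\<close>
    have "y 0 * n 0 \<le> ?c * n 0" unfolding eq by (rule le_add1)
    then have "y 0 \<le> ?c" using n_pos[of 0] by (simp only: mult_le_cancel2)
    with le have y0: "y 0 = 0" by linarith
    have "?c = ?z 0 - tuple_gcd ?z y 0" by (simp add: tuple_gcd_def y0)
    also have "\<dots> \<le> tuple_sum p (\<lambda>i. ?z i - tuple_gcd ?z y i)"
      unfolding tuple_sum_def by (rule member_le_sum) auto
    finally show ?thesis by (simp add: tuple_dist_def)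
  qed
  obtain y where y: "0 < y p" "?c * n 0 = (\<Sum>j\<in>{Suc 0..p}. y j * n j)"
    using upward_trades_exist[where s = s, OF sp enough p] by auto
  \<comment> \<open>The trades leave \<open>y 0\<close> unspecified, so it is reset.\<close>
  have "fact_hom p n (y(0 := 0)) = ?c * n 0"
    unfolding y fact_hom_first by simp
  then have "factorizations_at p n p (?c * n 0) \<noteq> {}"
    using truncated_factorization[of "y(0 := 0)" _ p] y(1) p by auto
  then show ?thesis
    using dist single_factorization[of 0 ?c]
    by (intro tame_degree_ge[where i = p and z = ?z and m = "?c * n 0"])
      (auto simp: S dest: n_pos intro: submonoid_gen_multiple)
qed

text \<open>Here the distance is bounded by the length of \<open>y\<close>, the second entry of the
  maximum in \<open>tuple_dist\<close>, whereas the upward bound uses the length of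
  \<open>z\<close>.\<close>

lemma tame_degree_ge_downward:
  fixes r :: "nat \<Rightarrow> nat"
  assumes r1: "r 1 = 1"
    and enough: "\<And>i. 1 \<le> i \<Longrightarrow> i < p \<Longrightarrow> a i * r i \<le> b (Suc i) * r (Suc i)"
    and least: "\<And>i x. 1 \<le> i \<Longrightarrow> i < p \<Longrightarrow> a i * r i \<le> b (Suc i) * x \<Longrightarrow> r (Suc i) \<le> x"
    and S: "S = submonoid_gen (n ` {0..p})"
  shows "ereal (real_of_int ((\<Sum>i\<in>{1..p - 1}. (int (b i) - int (a i)) * int (r i))
    + int (b p * r p))) \<le> tame_degree p n S"
    (is "ereal (real_of_int ?L) \<le> _")
proof -
  obtain q where q: "p = Suc q" using p_pos by (cases p) auto
  let ?c = "a p * r p"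
  let ?z = "\<lambda>j. if j = p then ?c else 0"
  have dist: "nat ?L \<le> tuple_dist p ?z y" if y: "y \<in> factorizations_at p n 0 (?c * n p)" for y
  proof -
    have y0: "0 < y 0" and eq: "?c * n p = y p * n p + (\<Sum>j\<le>q. y j * n j)"
      using y fact_hom_last[OF q, of y] by (auto simp: factorizations_at_def factorizations_def)
    have "(?c - y p) * n (Suc q) = (\<Sum>j\<le>q. y j * n j)"
      using eq by (simp add: diff_mult_distrib flip: q)
    from downward_trades_lower_bound[where r = r, OF r1 least y0 _ this]
    have le: "?c \<le> ?c - y p" and L: "?L + (int (?c - y p) - int ?c) \<le> int (\<Sum>j\<le>q. y j)"
      by (simp_all add: q)
    have "y p * n p \<le> ?c * n p" unfolding eq by (rule le_add1)
    then have "y p \<le> ?c" using n_pos[of p] by (simp only: mult_le_cancel2)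
    with le have yp: "y p = 0" by linarith
    \<comment> \<open>With \<open>y p = 0\<close> the excess term in \<open>L\<close>
      vanishes.\<close>
    have "nat ?L \<le> (\<Sum>j\<le>q. y j)" using L yp by (simp only: nat_le_iff)
    also have "\<dots> = (\<Sum>j\<le>q. y j - tuple_gcd ?z y j)"
      by (rule sum.cong) (auto simp: tuple_gcd_def q)
    also have "\<dots> \<le> tuple_sum p (\<lambda>i. y i - tuple_gcd ?z y i)"
      by (simp add: tuple_sum_def q atLeast0AtMost)
    finally show ?thesis by (simp add: tuple_dist_def)
  qed
  obtain y where y: "0 < y 0" "?c * n p = (\<Sum>j\<le>q. y j * n j)"
    using downward_trades_exist[where r = r and i = q, OF r1 enough] q by auto
  have "fact_hom p n (y(p := 0)) = ?c * n p"
    unfolding y fact_hom_last[OF q] by (simp, rule sum.cong) (auto simp: q)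
  then have "factorizations_at p n 0 (?c * n p) \<noteq> {}"
    using truncated_factorization[of "y(p := 0)" _ 0] y(1) q by auto
  then have "ereal (real (nat ?L)) \<le> tame_degree p n S"
    using dist single_factorization[of p ?c]
    by (intro tame_degree_ge[where i = 0 and z = ?z and m = "?c * n p"])
      (auto simp: S dest: n_pos intro: submonoid_gen_multiple)
  \<comment> \<open>\<open>nat\<close> never decreases an integer.\<close>
  moreover have "ereal (real_of_int ?L) \<le> ereal (real (nat ?L))"
    by (simp only: ereal_less_eq)
  ultimately show ?thesis by (rule order_trans[rotated])
qed

end

section \<open>From the integer recurrences to natural multiplicities\<close>

theorem theorem21:
  fixes p :: nat and a b :: "nat \<Rightarrow> nat" and S :: "nat set" and r s :: "nat \<Rightarrow> int"
  assumes "NSCS p a b S"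
    and "r 1 = 1"
    and "\<forall>i\<in>{2..p}. r i = \<lceil>real (a (i - 1)) * real_of_int (r (i - 1)) / real (b i)\<rceil>"
    and "s p = 1"
    and "\<forall>i\<in>{2..p}. s (i - 1) = \<lceil>real (b i) * real_of_int (s i) / real (a (i - 1))\<rceil>"
  shows "tame_degree p (compound_seq p a b) S \<ge>
    ereal (real_of_int (max
      ((\<Sum>i\<in>{1..p - 1}. (int (b i) - int (a i)) * r i) + int (b p) * r p)
      (int (b 1) * s 1)))"
proof -
  interpret compound p a b
    using assms(1) by unfold_locales (simp add: NSCS_def)
  have S: "S = submonoid_gen (n ` {0..p})"
    using assms(1) by (simp add: NSCS_def minimal_generators_def)
  have r: "r (Suc i) = \<lceil>real (a i) * real_of_int (r i) / real (b (Suc i))\<rceil>"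
    if "1 \<le> i" "i < p" for i
    using bspec[OF assms(3), of "Suc i"] that by simp
  have s: "s i = \<lceil>real (b (Suc i)) * real_of_int (s (Suc i)) / real (a i)\<rceil>"
    if "1 \<le> i" "i < p" for i
    using bspec[OF assms(5), of "Suc i"] that by simp
  have r_nonneg: "0 \<le> r i" if "1 \<le> i" "i \<le> p" for i
    using that
  proof (induction i rule: dec_induct)
    case base
    then show ?case using assms(2) by simp
  next
    case (step i)
    then show ?case
      using ceiling_divide_nat_least(3)[OF r _ _ refl, of i] b_pos[of "Suc i"] by simp
  qed
  \<comment> \<open>The recurrence for \<open>s\<close> starts at \<open>p\<close>, so the induction
    runs downwards.\<close>
  have s_nonneg: "0 \<le> s i" if "1 \<le> i" "i \<le> p" for i
    using that(2,1)
  proof (induction i rule: inc_induct)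
    case base
    then show ?case using assms(4) by simp
  next
    case (step i)
    then show ?case
      using ceiling_divide_nat_least(3)[OF s _ _ refl, of i] a_pos[of i] by simp
  qed
  have "ereal (real_of_int ((\<Sum>i\<in>{1..p - 1}. (int (b i) - int (a i)) * int (nat (r i)))
    + int (b p * nat (r p)))) \<le> tame_degree p n S"
    using assms(2) S ceiling_divide_nat_least(1,2)[OF r _ _ refl] r_nonneg b_pos
    by (intro tame_degree_ge_downward) auto
  also have "(\<Sum>i\<in>{1..p - 1}. (int (b i) - int (a i)) * int (nat (r i)))
      = (\<Sum>i\<in>{1..p - 1}. (int (b i) - int (a i)) * r i)"
    using r_nonneg by (intro sum.cong) auto
  also have "int (b p * nat (r p)) = int (b p) * r p"
    using r_nonneg[of p] p_pos by simp
  finally have down: "ereal (real_of_int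
    ((\<Sum>i\<in>{1..p - 1}. (int (b i) - int (a i)) * r i) + int (b p) * r p)) \<le> tame_degree p n S" .
  have "ereal (real (b 1 * nat (s 1))) \<le> tame_degree p n S"
    using assms(4) S ceiling_divide_nat_least(1,2)[OF s _ _ refl] s_nonneg a_pos
    by (intro tame_degree_ge_upward[where s = "\<lambda>i. nat (s i)"]) auto
  then have "ereal (real_of_int (int (b 1) * s 1)) \<le> tame_degree p n S"
    using s_nonneg[of 1] p_pos by simp
  with down show ?thesis unfolding max_def by (simp only: if_True if_False split: if_split) simp
qed

end
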